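(* Let $C_1$ and $C_2$ be two compact metrizable and stable convex subsets of locally convex Hausdorff vector spaces $X_1$ and $X_2$ respectively, and let $c:\mathrm{Ext}\,C_1\times \mathrm{Ext}\,C_2\to\mathbb{R}\cup\{+\infty\}$ be lower semicontinuous. Let $\mathcal{K}_c:\mathcal{P}(\mathrm{Ext}\,C_1)\times\mathcal{P}(\mathrm{Ext}\,C_2)\to\mathbb{R}\cup\{+\infty\}$ be the Kantorovich cost associated with $c$, and let $r_i:\mathcal{P}(\mathrm{Ext}\,C_i)\to C_i$, $i=1,2$, be the resultant maps. Then the convex roof $c_*:C_1\times C_2\to\mathbb{R}\cup\{+\infty\}$ of $c$ satisfies, for all $(x_1,x_2)\in C_1\times C_2$, $$c_*(x_1,x_2)=\inf_{\mu_1\in r_1^{-1}(\{x_1\})}\ \inf_{\mu_2\in r_2^{-1}(\{x_2\})}\mathcal{K}_c(\mu_1,\mu_2).$$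
   Context: $\mathrm{Ext}\,K$ denotes the set of extreme points of a convex set $K$; one has $\mathrm{Ext}(C_1\times C_2)=\mathrm{Ext}\,C_1\times \mathrm{Ext}\,C_2$. A convex set $K$ is stable when the midpoint map $K\times K\to K$, $(x,y)\mapsto(x+y)/2$, is open. $\mathcal{P}(E)$ is the set of Radon probability measures on $E$, and $X^*$ is the set of continuous real linear forms on a topological vector space $X$. For a convex subset $K$ of a locally convex Hausdorff space $\mathcal X$, $\pi\in\mathcal{P}(\mathrm{Ext}\,K)$ represents $x\in K$ if $\int_{\mathrm{Ext}K} f\,d\pi=f(x)$ for all $f\in \mathcal X^*$; the resultant map $r:\mathcal{P}(\mathrm{Ext}\,K)\to K$ sends $\pi$ to the (unique) point it represents, its barycenter. Under the assumptions of the claim the sets $\mathrm{Ext}\,C_i$ are closed and the resultant maps of $C_1$, $C_2$ and $C_1\times C_2$ are well-defined and surjective. The convex roof of a lower-bounded measurable $g:\mathrm{Ext}\,K\to\mathbb{R}\cup\{+\infty\}$ is $$g_*(x)=\inf_{\pi\in r^{-1}(\{x\})}\int_{\mathrm{Ext}K} g\,d\pi,\qquad x\in K;$$ here it is applied with $K=C_1\times C_2\subset X_1\times X_2$ and $g=c$. The Kantorovich cost is $\mathcal{K}_c(\mu,\nu)=\inf_\pi\iint c\,d\pi$, the infimum being over Radon probability measures $\pi$ on $\mathrm{Ext}\,C_1\times \mathrm{Ext}\,C_2$ with marginals $\mu$ and $\nu$. *)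

theory Defs
  imports "HOL-Probability.Probability"
begin

section \<open>Locally convex Hausdorff spaces\<close>

text \<open>Convexity is spelled out in the class axiom because \<^const>\<open>convex\<close> is not
  available for a type parameter still under construction.\<close>

class locally_convex_t2 = real_vector + topological_ab_group_add + t2_space +
  assumes tendsto_scaleR_Pair:
      "((\<lambda>p. fst p *\<^sub>R snd p) \<longlongrightarrow> a *\<^sub>R x) (nhds (a::real) \<times>\<^sub>F nhds x)"
    and ex_convex_nhd: "open U \<Longrightarrow> 0 \<in> U \<Longrightarrow> \<exists>V. open V \<and> 0 \<in> V \<and> V \<subseteq> U \<and>
        (\<forall>x\<in>V. \<forall>y\<in>V. \<forall>u\<ge>0. \<forall>v\<ge>0. u + v = 1 \<longrightarrow> u *\<^sub>R x + v *\<^sub>R y \<in> V)"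

lemma convex_nhds_base:
  fixes U :: "'a::locally_convex_t2 set"
  assumes "open U" "0 \<in> U"
  shows "\<exists>V. open V \<and> convex V \<and> 0 \<in> V \<and> V \<subseteq> U"
  using ex_convex_nhd[OF assms] by (auto simp only: convex_def)

instance real_normed_vector < locally_convex_t2
proof
  fix a :: real and x :: 'a
  show "((\<lambda>p. fst p *\<^sub>R snd p) \<longlongrightarrow> a *\<^sub>R x) (nhds a \<times>\<^sub>F nhds x)"
    by (intro tendsto_scaleR filterlim_fst filterlim_snd)
next
  fix U :: "'a set"
  assume "open U" "0 \<in> U"
  then obtain e where "e > 0" "ball 0 e \<subseteq> U"
    by (auto simp: open_contains_ball)
  then show "\<exists>V. open V \<and> 0 \<in> V \<and> V \<subseteq> U \<and>
      (\<forall>x\<in>V. \<forall>y\<in>V. \<forall>u\<ge>0. \<forall>v\<ge>0. u + v = 1 \<longrightarrow> u *\<^sub>R x + v *\<^sub>R y \<in> V)"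
    using convex_ball[of "0::'a" e] \<open>e > 0\<close> \<open>ball 0 e \<subseteq> U\<close>
    unfolding convex_def by (intro exI[of _ "ball 0 e"] conjI) (simp_all only: open_ball centre_in_ball)
qed

instance prod :: (topological_monoid_add, topological_monoid_add) topological_monoid_add
proof
  fix a b :: "'a \<times> 'b"
  have "((\<lambda>p. (fst (fst p) + fst (snd p), snd (fst p) + snd (snd p)))
      \<longlongrightarrow> (fst a + fst b, snd a + snd b)) (nhds a \<times>\<^sub>F nhds b)"
    by (intro tendsto_Pair tendsto_add tendsto_fst tendsto_snd filterlim_fst filterlim_snd)
  then show "((\<lambda>p. fst p + snd p) \<longlongrightarrow> a + b) (nhds a \<times>\<^sub>F nhds b)"
    by (simp add: plus_prod_def)
qed

instance prod :: (topological_comm_monoid_add, topological_comm_monoid_add) topological_comm_monoid_add ..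

instance prod :: (topological_group_add, topological_group_add) topological_group_add
proof
  fix a :: "'a \<times> 'b"
  have "((\<lambda>p::'a \<times> 'b. (- fst p, - snd p)) \<longlongrightarrow> (- fst a, - snd a)) (nhds a)"
    by (intro tendsto_Pair tendsto_minus tendsto_fst tendsto_snd filterlim_ident)
  then show "(uminus \<longlongrightarrow> - a) (nhds a)"
    by (simp add: uminus_prod_def[abs_def])
qed

instance prod :: (topological_ab_group_add, topological_ab_group_add) topological_ab_group_add ..

instance prod :: (locally_convex_t2, locally_convex_t2) locally_convex_t2
proof
  fix a :: real and x :: "'a \<times> 'b"
  have fst_lim: "filterlim fst (nhds a) (nhds a \<times>\<^sub>F nhds x)"
    by (rule filterlim_fst)
  have lim1: "((\<lambda>p. fst (snd p)) \<longlongrightarrow> fst x) (nhds a \<times>\<^sub>F nhds x)"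
    by (rule tendsto_fst) (rule filterlim_snd)
  have lim2: "((\<lambda>p. snd (snd p)) \<longlongrightarrow> snd x) (nhds a \<times>\<^sub>F nhds x)"
    by (rule tendsto_snd) (rule filterlim_snd)
  have "((\<lambda>p. fst p *\<^sub>R fst (snd p)) \<longlongrightarrow> a *\<^sub>R fst x) (nhds a \<times>\<^sub>F nhds x)"
    using filterlim_compose[OF tendsto_scaleR_Pair filterlim_Pair[OF fst_lim lim1]] by simp
  moreover have "((\<lambda>p. fst p *\<^sub>R snd (snd p)) \<longlongrightarrow> a *\<^sub>R snd x) (nhds a \<times>\<^sub>F nhds x)"
    using filterlim_compose[OF tendsto_scaleR_Pair filterlim_Pair[OF fst_lim lim2]] by simp
  ultimately show "((\<lambda>p. fst p *\<^sub>R snd p) \<longlongrightarrow> a *\<^sub>R x) (nhds a \<times>\<^sub>F nhds x)"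
    unfolding scaleR_prod_def by (rule tendsto_Pair)
next
  fix U :: "('a \<times> 'b) set"
  assume "open U" "0 \<in> U"
  then obtain A B where AB: "open A" "open B" "0 \<in> A \<times> B" "A \<times> B \<subseteq> U"
    by (rule open_prod_elim)
  then have "0 \<in> A" "0 \<in> B"
    by (auto simp: zero_prod_def)
  obtain V where V: "open V" "convex V" "0 \<in> V" "V \<subseteq> A"
    using convex_nhds_base[OF \<open>open A\<close> \<open>0 \<in> A\<close>] by blast
  obtain W where W: "open W" "convex W" "0 \<in> W" "W \<subseteq> B"
    using convex_nhds_base[OF \<open>open B\<close> \<open>0 \<in> B\<close>] by blast
  have "open (V \<times> W) \<and> convex (V \<times> W) \<and> 0 \<in> V \<times> W \<and> V \<times> W \<subseteq> U"
    using V W AB(4) by (intro conjI open_Times convex_Times) (auto simp: zero_prod_def)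
  then show "\<exists>V. open V \<and> 0 \<in> V \<and> V \<subseteq> U \<and>
      (\<forall>x\<in>V. \<forall>y\<in>V. \<forall>u\<ge>0. \<forall>v\<ge>0. u + v = 1 \<longrightarrow> u *\<^sub>R x + v *\<^sub>R y \<in> V)"
    unfolding convex_def by (elim conjE) (intro exI[of _ "V \<times> W"] conjI)
qed

definition topological_dual :: "('a::locally_convex_t2 \<Rightarrow> real) set"
  where "topological_dual = {f. linear f \<and> continuous_on UNIV f}"

section \<open>Stability, extreme points, lower semicontinuity\<close>

definition Ext :: "'a::real_vector set \<Rightarrow> 'a set"
  where "Ext K = {x. x extreme_point_of K}"

definition stable_set :: "'a::locally_convex_t2 set \<Rightarrow> bool"
  where "stable_set K \<longleftrightarrow> open_map (top_of_set (K \<times> K)) (top_of_set K) (\<lambda>(x, y). midpoint x y)"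

definition lsc_on :: "'a::topological_space set \<Rightarrow> ('a \<Rightarrow> ereal) \<Rightarrow> bool"
  where "lsc_on E g \<longleftrightarrow> (\<forall>a. openin (top_of_set E) {x \<in> E. a < g x})"

section \<open>Radon probability measures and integrals\<close>

text \<open>The trace on \<open>E\<close> of the Borel sets is the Borel algebra of the subspace \<open>E\<close>.
  Local finiteness is automatic for probability measures.\<close>

definition radon_prob :: "'a::t2_space set \<Rightarrow> 'a measure set"
  where "radon_prob E = {M. prob_space M \<and> sets M = sets (restrict_space borel E) \<and>
    (\<forall>A\<in>sets M. emeasure M A = (SUP K\<in>{K. compact K \<and> K \<subseteq> A}. emeasure M K))}"

text \<open>Integral of positive part minus integral of negative part: \<open>e2ennreal\<close> sends
  negative numbers to \<open>0\<close>. For integrands bounded below and finite measures the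
  subtracted term is finite.\<close>

definition ereal_integral :: "'a measure \<Rightarrow> ('a \<Rightarrow> ereal) \<Rightarrow> ereal"
  where "ereal_integral M g =
    enn2ereal (\<integral>\<^sup>+ x. e2ennreal (g x) \<partial>M) - enn2ereal (\<integral>\<^sup>+ x. e2ennreal (- g x) \<partial>M)"

section \<open>Resultant map, convex roof, Kantorovich cost\<close>

definition represents :: "'a::locally_convex_t2 measure \<Rightarrow> 'a \<Rightarrow> bool"
  where "represents \<pi> x \<longleftrightarrow> (\<forall>f\<in>topological_dual. has_bochner_integral \<pi> f (f x))"

definition resultant :: "'a::locally_convex_t2 set \<Rightarrow> 'a measure \<Rightarrow> 'a"
  where "resultant K \<pi> = (THE x. x \<in> K \<and> represents \<pi> x)"

definition resultant_fibre :: "'a::locally_convex_t2 set \<Rightarrow> 'a \<Rightarrow> 'a measure set"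
  where "resultant_fibre K x = {\<pi> \<in> radon_prob (Ext K). resultant K \<pi> = x}"

definition convex_roof :: "'a::locally_convex_t2 set \<Rightarrow> ('a \<Rightarrow> ereal) \<Rightarrow> 'a \<Rightarrow> ereal"
  where "convex_roof K g x = (INF \<pi>\<in>resultant_fibre K x. ereal_integral \<pi> g)"

definition couplings ::
  "'a::t2_space set \<Rightarrow> 'b::t2_space set \<Rightarrow> 'a measure \<Rightarrow> 'b measure \<Rightarrow> ('a \<times> 'b) measure set"
  where "couplings E F \<mu> \<nu> = {\<pi> \<in> radon_prob (E \<times> F).
    distr \<pi> (restrict_space borel E) fst = \<mu> \<and> distr \<pi> (restrict_space borel F) snd = \<nu>}"

definition kantorovich_cost ::
  "'a::t2_space set \<Rightarrow> 'b::t2_space set \<Rightarrow> ('a \<times> 'b \<Rightarrow> ereal) \<Rightarrow> 'a measure \<Rightarrow> 'b measure \<Rightarrow> ereal"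
  where "kantorovich_cost E F c \<mu> \<nu> = (INF \<pi>\<in>couplings E F \<mu> \<nu>. ereal_integral \<pi> c)"

end

theory Submission
  imports Defs
begin

text \<open>Pushing forward along the two projections shows that a measure on
  \<open>Ext C1 \<times> Ext C2 = Ext (C1 \<times> C2)\<close> represents \<open>(x1, x2)\<close> iff its marginals represent
  \<open>x1\<close> and \<open>x2\<close>: continuous linear forms on the product are sums of forms on the factors.
  Hence the fibre of the resultant map over \<open>(x1, x2)\<close> is the union of the couplings of pairs of
  measures in the fibres over \<open>x1\<close> and \<open>x2\<close>, and the infimum splits. As \<open>resultant\<close>
  is a definite description, this needs that each measure on \<open>Ext K\<close> has exactly one
  barycenter; uniqueness is the Hahn--Banach theorem. Stability makes \<open>Ext C1\<close> and \<open>Ext C2\<close>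
  compact, so the lower semicontinuous cost is bounded below, which excludes \<open>-\<infinity>\<close>.\<close>

section \<open>The Hahn--Banach theorem\<close>

definition sublinear :: "('a::real_vector \<Rightarrow> real) \<Rightarrow> bool"
  where "sublinear q \<longleftrightarrow> (\<forall>x y. q (x + y) \<le> q x + q y) \<and> (\<forall>t\<ge>0. \<forall>x. q (t *\<^sub>R x) = t * q x)"

lemma sublinear_add: "sublinear q \<Longrightarrow> q (x + y) \<le> q x + q y"
  and sublinear_scale: "sublinear q \<Longrightarrow> 0 \<le> t \<Longrightarrow> q (t *\<^sub>R x) = t * q x"
  by (simp_all add: sublinear_def)

lemma sublinear_zero: "sublinear q \<Longrightarrow> q 0 = 0"
  using sublinear_scale[of q 0 0] by simp

lemma sublinear_ge_minus: "sublinear q \<Longrightarrow> - q (- x) \<le> q x"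
  using sublinear_add[of q x "- x"] by (simp add: sublinear_zero)

text \<open>The largest sublinear functional below \<open>q\<close> whose value at \<open>- z\<close> is at most \<open>- q z\<close>;
  a sublinear functional equal to all its tilts is additive.\<close>

definition tilt :: "('a::real_vector \<Rightarrow> real) \<Rightarrow> 'a \<Rightarrow> 'a \<Rightarrow> real"
  where "tilt q z x = (INF t\<in>{0..}. q (x + t *\<^sub>R z) - t * q z)"

context
  fixes q :: "'a::real_vector \<Rightarrow> real" and z :: 'a
  assumes q: "sublinear q"
begin

lemma tilt_le:
  assumes "0 \<le> t"
  shows "tilt q z x \<le> q (x + t *\<^sub>R z) - t * q z"
proof -
  \<comment> \<open>Since \<open>q (s *\<^sub>R z) = s * q z\<close>, subadditivity gives a lower
    bound independent of \<open>s\<close>. The real infimum in \<open>tilt\<close> is thus taken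
    over a set bounded below.\<close>
  have "- q (- x) \<le> q (x + s *\<^sub>R z) - s * q z" if "0 \<le> s" for s
    using sublinear_add[OF q, of "x + s *\<^sub>R z" "- x"] sublinear_scale[OF q that, of z] by simp
  then have "bdd_below ((\<lambda>t. q (x + t *\<^sub>R z) - t * q z) ` {0..})"
    by (auto intro!: bdd_belowI)
  then show ?thesis
    unfolding tilt_def using assms by (intro cINF_lower) auto
qed

lemma tilt_greatest:
  assumes "\<And>t. 0 \<le> t \<Longrightarrow> b \<le> q (x + t *\<^sub>R z) - t * q z"
  shows "b \<le> tilt q z x"
  unfolding tilt_def using assms by (intro cINF_greatest) auto

text \<open>Scaling by \<open>t\<close> reparametrises the infimum through \<open>t * s\<close>. One
  inequality suffices for homogeneity, since applying it with factor \<open>1 / t\<close> gives the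
  reverse one.\<close>

lemma tilt_scale_le:
  assumes "0 < t"
  shows "tilt q z (t *\<^sub>R x) \<le> t * tilt q z x"
proof -
  have "tilt q z (t *\<^sub>R x) / t \<le> tilt q z x"
  proof (rule tilt_greatest)
    fix s :: real assume "0 \<le> s"
    then have "tilt q z (t *\<^sub>R x) \<le> q (t *\<^sub>R x + (t * s) *\<^sub>R z) - (t * s) * q z"
      using assms by (intro tilt_le) simp
    also have "t *\<^sub>R x + (t * s) *\<^sub>R z = t *\<^sub>R (x + s *\<^sub>R z)"
      by (simp add: scaleR_add_right)
    also have "q \<dots> = t * q (x + s *\<^sub>R z)"
      using assms by (intro sublinear_scale[OF q]) simp
    finally show "tilt q z (t *\<^sub>R x) / t \<le> q (x + s *\<^sub>R z) - s * q z"
      using assms by (simp add: field_simps)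
  qed
  then show ?thesis
    using assms by (simp add: field_simps)
qed

lemma sublinear_tilt: "sublinear (tilt q z)"
  unfolding sublinear_def
proof (intro conjI allI impI)
  fix x y
  have "tilt q z (x + y) - tilt q z y \<le> tilt q z x"
  proof (rule tilt_greatest)
    fix s :: real assume s: "0 \<le> s"
    have "tilt q z (x + y) - (q (x + s *\<^sub>R z) - s * q z) \<le> tilt q z y"
    proof (rule tilt_greatest)
      fix t :: real assume t: "0 \<le> t"
      have "tilt q z (x + y) \<le> q ((x + y) + (s + t) *\<^sub>R z) - (s + t) * q z"
        using s t by (intro tilt_le) simp
      also have "(x + y) + (s + t) *\<^sub>R z = (x + s *\<^sub>R z) + (y + t *\<^sub>R z)"
        by (simp add: scaleR_add_left)
      also have "q \<dots> \<le> q (x + s *\<^sub>R z) + q (y + t *\<^sub>R z)"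
        by (rule sublinear_add[OF q])
      finally show "tilt q z (x + y) - (q (x + s *\<^sub>R z) - s * q z) \<le> q (y + t *\<^sub>R z) - t * q z"
        by (simp add: algebra_simps)
    qed
    then show "tilt q z (x + y) - tilt q z y \<le> q (x + s *\<^sub>R z) - s * q z"
      by simp
  qed
  then show "tilt q z (x + y) \<le> tilt q z x + tilt q z y"
    by simp
next
  fix t :: real and x assume "0 \<le> t"
  show "tilt q z (t *\<^sub>R x) = t * tilt q z x"
  proof (cases "t = 0")
    case True
    have "(\<lambda>s. q (0 + s *\<^sub>R z) - s * q z) ` {0..} = (\<lambda>s::real. 0) ` {0..}"
      by (rule image_cong) (simp_all add: sublinear_scale[OF q])
    then have "tilt q z 0 = 0"
      by (simp add: tilt_def)
    then show ?thesis
      using True by simp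
  next
    case False
    then have t: "0 < t"
      using \<open>0 \<le> t\<close> by simp
    have "tilt q z x \<le> (1 / t) * tilt q z (t *\<^sub>R x)"
      using tilt_scale_le[of "1 / t" "t *\<^sub>R x"] t by simp
    then have "t * tilt q z x \<le> tilt q z (t *\<^sub>R x)"
      using t by (simp add: field_simps)
    with tilt_scale_le[OF t, of x] show ?thesis
      by simp
  qed
qed

lemma tilt_le_self: "tilt q z x \<le> q x"
  using tilt_le[of 0 x] by simp

lemma tilt_minus: "tilt q z (- z) \<le> - q z"
  using tilt_le[of 1 "- z"] by (simp add: sublinear_zero[OF q])

end

section \<open>Minimal sublinear functionals are linear\<close>

text \<open>This supplies the bounds of chains for Zorn's lemma. Domination by \<open>p\<close>
  gives \<open>- p (- x) <= - q (- x) <= q x\<close>, so the infima are finite. Subadditivity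
  survives because two members of a chain can be replaced by the smaller one.\<close>

lemma sublinear_INF_chain:
  fixes C :: "('a::real_vector \<Rightarrow> real) set"
  assumes "C \<noteq> {}" and C: "\<And>q. q \<in> C \<Longrightarrow> sublinear q \<and> (\<forall>x. q x \<le> p x)"
    and chain: "\<And>q q'. q \<in> C \<Longrightarrow> q' \<in> C \<Longrightarrow> q \<le> q' \<or> q' \<le> q"
  shows "sublinear (\<lambda>x. INF q\<in>C. q x)" and "q \<in> C \<Longrightarrow> (INF q\<in>C. q x) \<le> q x"
proof -
  have lower: "(INF q\<in>C. q x) \<le> q x" if "q \<in> C" for q x
  proof (rule cINF_lower[OF _ that])
    have "- p (- x) \<le> q x" if "q \<in> C" for q
      using C[OF that] sublinear_ge_minus[of q x] by (meson neg_le_iff_le order_trans)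
    then show "bdd_below ((\<lambda>q. q x) ` C)"
      by (auto intro!: bdd_belowI)
  qed
  then show "q \<in> C \<Longrightarrow> (INF q\<in>C. q x) \<le> q x" .
  have greatest: "b \<le> (INF q\<in>C. q x)" if "\<And>q. q \<in> C \<Longrightarrow> b \<le> q x" for b x
    using that \<open>C \<noteq> {}\<close> by (intro cINF_greatest) auto
  have scale: "t * (INF q\<in>C. q x) \<le> (INF q\<in>C. q (t *\<^sub>R x))" if "0 \<le> t" for t x
    using lower C that by (intro greatest) (auto simp: sublinear_scale mult_left_mono)
  show "sublinear (\<lambda>x. INF q\<in>C. q x)"
    unfolding sublinear_def
  proof (intro conjI allI impI)
    fix x y
    have "(INF q\<in>C. q (x + y)) - (INF q\<in>C. q y) \<le> (INF q\<in>C. q x)"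
    proof (rule greatest)
      fix q assume q: "q \<in> C"
      have "(INF q\<in>C. q (x + y)) - q x \<le> (INF q\<in>C. q y)"
      proof (rule greatest)
        fix q' assume q': "q' \<in> C"
        obtain r where r: "r \<in> C" "r \<le> q" "r \<le> q'"
          using chain[OF q q'] q q' by blast
        have "(INF q\<in>C. q (x + y)) \<le> r (x + y)"
          by (rule lower[OF r(1)])
        also have "\<dots> \<le> r x + r y"
          using C[OF r(1)] by (simp add: sublinear_add)
        also have "\<dots> \<le> q x + q' y"
          using r by (intro add_mono) (auto simp: le_fun_def)
        finally show "(INF q\<in>C. q (x + y)) - q x \<le> q' y"
          by simp
      qed
      then show "(INF q\<in>C. q (x + y)) - (INF q\<in>C. q y) \<le> q x"
        by simp
    qed
    then show "(INF q\<in>C. q (x + y)) \<le> (INF q\<in>C. q x) + (INF q\<in>C. q y)"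
      by simp
  next
    fix t :: real and x assume t: "0 \<le> t"
    show "(INF q\<in>C. q (t *\<^sub>R x)) = t * (INF q\<in>C. q x)"
    proof (cases "t = 0")
      case True
      then have "(\<lambda>q. q (t *\<^sub>R x)) ` C = (\<lambda>q. 0) ` C"
        using C by (intro image_cong) (simp_all add: sublinear_zero)
      then show ?thesis
        using True \<open>C \<noteq> {}\<close> by simp
    next
      case False
      then have "t > 0"
        using t by simp
      moreover have "(1 / t) * (INF q\<in>C. q (t *\<^sub>R x)) \<le> (INF q\<in>C. q ((1 / t) *\<^sub>R t *\<^sub>R x))"
        using t by (intro scale) simp
      ultimately have "(INF q\<in>C. q (t *\<^sub>R x)) \<le> t * (INF q\<in>C. q x)"
        by (simp add: field_simps)
      with scale[OF t, of x] show ?thesis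
        by simp
    qed
  qed
qed

lemma ex_minimal_sublinear:
  assumes "sublinear p"
  shows "\<exists>m. sublinear m \<and> m \<le> p \<and> (\<forall>q. sublinear q \<and> q \<le> m \<longrightarrow> q = m)"
proof -
  define A where "A = {q. sublinear q \<and> q \<le> p}"
  \<comment> \<open>Zorn's lemma for the reversed order: maximal elements are minimal functionals,
    and an upper bound of a nonempty chain is its pointwise infimum. The empty chain is bounded by
    \<open>p\<close> itself.\<close>
  have "\<exists>m\<in>A. \<forall>q\<in>A. m \<ge> q \<longrightarrow> q = m"
  proof (rule predicate_Zorn)
    show "partial_order_on A (relation_of (\<ge>) A)"
      by (rule partial_order_on_relation_ofI) auto
  next
    fix C assume C: "C \<in> Chains (relation_of (\<ge>) A)"
    then have sub: "C \<subseteq> A" and chain: "\<And>q q'. q \<in> C \<Longrightarrow> q' \<in> C \<Longrightarrow> q \<le> q' \<or> q' \<le> q"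
      by (auto simp: Chains_def relation_of_def)
    show "\<exists>u\<in>A. \<forall>q\<in>C. q \<ge> u"
    proof (cases "C = {}")
      case True
      then show ?thesis
        using assms by (auto simp: A_def)
    next
      case False
      have CA: "\<And>q. q \<in> C \<Longrightarrow> sublinear q \<and> (\<forall>x. q x \<le> p x)"
        using sub by (auto simp: A_def le_fun_def)
      note inf = sublinear_INF_chain[OF False CA chain]
      have le: "(\<lambda>x. INF q\<in>C. q x) \<le> q" if "q \<in> C" for q
        using inf(2) that by (simp add: le_fun_def)
      obtain q where "q \<in> C"
        using False by blast
      then have "(\<lambda>x. INF q\<in>C. q x) \<le> p"
        using le sub by (force simp: A_def intro: order_trans)
      then have "(\<lambda>x. INF q\<in>C. q x) \<in> A"
        using inf(1) by (simp add: A_def)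
      then show ?thesis
        using le by blast
    qed
  qed
  then show ?thesis
    by (auto simp: A_def intro: order_trans)
qed

text \<open>Every tilt lies below \<open>m\<close>, so minimality makes it equal to
  \<open>m\<close>. The parameter value 1 in the tilt then shows that \<open>m\<close> is
  superadditive, hence additive.\<close>

lemma minimal_sublinear_imp_linear:
  assumes m: "sublinear m" and minimal: "\<And>q. sublinear q \<Longrightarrow> q \<le> m \<Longrightarrow> q = m"
  shows "linear m"
proof -
  have "tilt m z = m" for z
    using m by (intro minimal sublinear_tilt) (auto simp: le_fun_def tilt_le_self)
  then have "m x \<le> m (x + z) - m z" for x z
    using tilt_le[OF m, of 1 z x] by simp
  then have add: "m (x + y) = m x + m y" for x y
    using sublinear_add[OF m, of x y] by (smt (verit))
  have minus: "m (- x) = - m x" for x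
    using add[of x "- x"] by (simp add: sublinear_zero[OF m])
  have "m (t *\<^sub>R x) = t * m x" for t x
    using sublinear_scale[OF m, of "\<bar>t\<bar>" x] minus[of "t *\<^sub>R x"] by (cases "0 \<le> t") auto
  with add show ?thesis
    by (intro linearI) auto
qed

text \<open>Minimising below \<open>tilt p z\<close> instead of \<open>p\<close> builds in the value
  at \<open>z\<close>: the linear minimum \<open>m\<close> satisfies
  \<open>- m z = m (- z) <= - p z\<close>, while \<open>m z <= p z\<close> holds anyway.\<close>

theorem hahn_banach_sublinear:
  assumes p: "sublinear p"
  shows "\<exists>f. linear f \<and> (\<forall>x. f x \<le> p x) \<and> f z = p z"
proof -
  obtain m where m: "sublinear m" "m \<le> tilt p z" "\<forall>q. sublinear q \<and> q \<le> m \<longrightarrow> q = m"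
    using ex_minimal_sublinear[OF sublinear_tilt[OF p]] by blast
  then have lin: "linear m"
    by (intro minimal_sublinear_imp_linear) auto
  have le: "m x \<le> p x" for x
    using m(2) tilt_le_self[OF p, of z x] by (auto simp: le_fun_def intro: order_trans)
  have "- m z \<le> - p z"
    using m(2) tilt_minus[OF p, of z] linear_neg[OF lin, of z]
    by (metis le_fun_def order_trans)
  then have "m z = p z"
    using le[of z] by simp
  with lin le show ?thesis
    by blast
qed

section \<open>Minkowski functionals and separation of points\<close>

lemma tendsto_scaleR_lc:
  fixes g :: "'b \<Rightarrow> 'a::locally_convex_t2"
  assumes "(f \<longlongrightarrow> a) F" "(g \<longlongrightarrow> x) F"
  shows "((\<lambda>t. f t *\<^sub>R g t) \<longlongrightarrow> a *\<^sub>R x) F"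
  using filterlim_compose[OF tendsto_scaleR_Pair filterlim_Pair[OF assms]] by simp

definition minkowski :: "'a::real_vector set \<Rightarrow> 'a \<Rightarrow> real"
  where "minkowski V x = Inf {t. 0 < t \<and> (1 / t) *\<^sub>R x \<in> V}"

context
  fixes V :: "'a::locally_convex_t2 set"
  assumes V: "open V" "convex V" "0 \<in> V"
begin

lemma minkowski_nonempty: "\<exists>t>0. (1 / t) *\<^sub>R x \<in> V"
proof -
  \<comment> \<open>As \<open>t\<close> decreases to 0, the multiples of \<open>x\<close> tend to 0,
    so the neighbourhood \<open>V\<close> of 0 absorbs \<open>x\<close>.\<close>
  have "((\<lambda>t::real. t *\<^sub>R x) \<longlongrightarrow> 0 *\<^sub>R x) (at_right 0)"
    by (intro tendsto_scaleR_lc tendsto_const tendsto_ident_at)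
  then have "eventually (\<lambda>t::real. t *\<^sub>R x \<in> V) (at_right 0)"
    using V by (auto dest: topological_tendstoD)
  moreover have "eventually (\<lambda>t::real. t > 0) (at_right 0)"
    by (simp add: eventually_at_right_less)
  ultimately have "eventually (\<lambda>t::real. t > 0 \<and> t *\<^sub>R x \<in> V) (at_right 0)"
    by eventually_elim simp
  then obtain t :: real where "t > 0" "t *\<^sub>R x \<in> V"
    using eventually_happens[of _ "at_right (0::real)"] by auto
  then show ?thesis
    by (intro exI[of _ "1 / t"]) simp
qed

lemma minkowski_le: "0 < t \<Longrightarrow> (1 / t) *\<^sub>R x \<in> V \<Longrightarrow> minkowski V x \<le> t"
  unfolding minkowski_def by (intro cInf_lower bdd_belowI[of _ 0]) auto

lemma minkowski_greatest:
  "(\<And>t. 0 < t \<Longrightarrow> (1 / t) *\<^sub>R x \<in> V \<Longrightarrow> b \<le> t) \<Longrightarrow> b \<le> minkowski V x"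
  unfolding minkowski_def using minkowski_nonempty[of x] by (intro cInf_greatest) auto

lemma minkowski_nonneg: "0 \<le> minkowski V x"
  by (rule minkowski_greatest) simp

lemma minkowski_scale_le:
  assumes "0 < s"
  shows "minkowski V (s *\<^sub>R x) \<le> s * minkowski V x"
proof -
  have "minkowski V (s *\<^sub>R x) / s \<le> minkowski V x"
  proof (rule minkowski_greatest)
    fix t assume "0 < t" "(1 / t) *\<^sub>R x \<in> V"
    then have "minkowski V (s *\<^sub>R x) \<le> s * t"
      using assms by (intro minkowski_le) simp_all
    then show "minkowski V (s *\<^sub>R x) / s \<le> t"
      using assms by (simp add: field_simps)
  qed
  then show ?thesis
    using assms by (simp add: field_simps)
qed

lemma sublinear_minkowski: "sublinear (minkowski V)"
  unfolding sublinear_def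
proof (intro conjI allI impI)
  fix x y
  have "minkowski V (x + y) - minkowski V y \<le> minkowski V x"
  proof (rule minkowski_greatest)
    fix s assume s: "0 < s" "(1 / s) *\<^sub>R x \<in> V"
    have "minkowski V (x + y) - s \<le> minkowski V y"
    proof (rule minkowski_greatest)
      fix t assume t: "0 < t" "(1 / t) *\<^sub>R y \<in> V"
      \<comment> \<open>The weights are chosen so that the convex combination of
        \<open>x / s\<close> and \<open>y / t\<close> collapses to
        \<open>(x + y) / (s + t)\<close>.\<close>
      have "(s / (s + t)) *\<^sub>R (1 / s) *\<^sub>R x + (t / (s + t)) *\<^sub>R (1 / t) *\<^sub>R y \<in> V"
        using s t V(2) by (intro convexD) (auto simp: add_divide_distrib[symmetric])
      then have "(1 / (s + t)) *\<^sub>R (x + y) \<in> V"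
        using s t by (simp add: scaleR_add_right)
      then have "minkowski V (x + y) \<le> s + t"
        using s t by (intro minkowski_le) auto
      then show "minkowski V (x + y) - s \<le> t"
        by simp
    qed
    then show "minkowski V (x + y) - minkowski V y \<le> s"
      by simp
  qed
  then show "minkowski V (x + y) \<le> minkowski V x + minkowski V y"
    by simp
next
  fix t :: real and x assume "0 \<le> t"
  show "minkowski V (t *\<^sub>R x) = t * minkowski V x"
  proof (cases "t = 0")
    case True
    have "minkowski V 0 \<le> e" if "0 < e" for e
      using that V(3) by (intro minkowski_le) auto
    then have "minkowski V 0 \<le> 0"
      by (meson dense_ge)
    then show ?thesis
      using True minkowski_nonneg[of 0] by simp
  next
    case False
    then have t: "0 < t"
      using \<open>0 \<le> t\<close> by simp
    have "minkowski V x \<le> (1 / t) * minkowski V (t *\<^sub>R x)"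
      using minkowski_scale_le[of "1 / t" "t *\<^sub>R x"] t by simp
    then have "t * minkowski V x \<le> minkowski V (t *\<^sub>R x)"
      using t by (simp add: field_simps)
    with minkowski_scale_le[OF t, of x] show ?thesis
      by simp
  qed
qed

lemma minkowski_le_1: "x \<in> V \<Longrightarrow> minkowski V x \<le> 1"
  by (rule minkowski_le) auto

text \<open>A convex set containing 0 is starshaped about 0: if \<open>x / t\<close> were in
  \<open>V\<close> for some \<open>t < 1\<close>, shrinking it by \<open>t\<close> would put
  \<open>x\<close> into \<open>V\<close>.\<close>

lemma minkowski_ge_1:
  assumes "x \<notin> V"
  shows "1 \<le> minkowski V x"
proof (rule minkowski_greatest)
  fix t assume t: "0 < t" "(1 / t) *\<^sub>R x \<in> V"
  show "1 \<le> t"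
  proof (rule ccontr)
    assume "\<not> 1 \<le> t"
    then have "t *\<^sub>R (1 / t) *\<^sub>R x + (1 - t) *\<^sub>R 0 \<in> V"
      using t V by (intro convexD) auto
    then show False
      using t assms by simp
  qed
qed

text \<open>The bound gives \<open>f <= 1\<close> on \<open>V\<close>. As \<open>V\<close> may fail
  to be symmetric, the two-sided bound holds for points of \<open>V\<close> whose negatives also lie
  in \<open>V\<close>; these form a neighbourhood of 0, and rescaling it gives continuity
  everywhere.\<close>

lemma linear_le_minkowski_continuous:
  assumes f: "linear f" and le: "\<And>x. f x \<le> minkowski V x"
  shows "continuous_on UNIV f"
proof -
  have abs_le: "\<bar>f x\<bar> \<le> 1" if "x \<in> V" "- x \<in> V" for x
    using le[of x] le[of "- x"] minkowski_le_1[OF that(1)] minkowski_le_1[OF that(2)]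
    by (simp add: linear_neg[OF f])
  have "(f \<longlongrightarrow> f x) (at x)" for x
  proof (rule tendstoI)
    fix e :: real assume e: "0 < e"
    \<comment> \<open>The factor \<open>2 / e\<close> turns the bound 1 on \<open>f (g y)\<close>
      into a distance of at most \<open>e / 2\<close>, which is strictly less than
      \<open>e\<close>.\<close>
    define g where "g y = (2 / e) *\<^sub>R (y - x)" for y
    have "(g \<longlongrightarrow> (2 / e) *\<^sub>R (x - x)) (at x)"
      unfolding g_def by (intro tendsto_scaleR_lc tendsto_intros)
    then have g0: "(g \<longlongrightarrow> 0) (at x)"
      by simp
    then have "((\<lambda>y. - g y) \<longlongrightarrow> - 0) (at x)"
      by (rule tendsto_minus)
    then have "eventually (\<lambda>y. - g y \<in> V) (at x)"
      using V by (auto dest: topological_tendstoD)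
    moreover have "eventually (\<lambda>y. g y \<in> V) (at x)"
      using g0 V by (auto dest: topological_tendstoD)
    ultimately show "eventually (\<lambda>y. dist (f y) (f x) < e) (at x)"
    proof eventually_elim
      case (elim y)
      then have "\<bar>f (g y)\<bar> \<le> 1"
        by (intro abs_le)
      also have "f (g y) = (2 / e) * (f y - f x)"
        by (simp add: g_def linear_scale[OF f] linear_diff[OF f])
      finally show ?case
        using e by (simp add: abs_mult dist_real_def field_simps)
    qed
  qed
  then show ?thesis
    by (simp add: continuous_on_def)
qed

end

text \<open>A convex neighbourhood of 0 that misses \<open>x - y\<close> has Minkowski functional at
  least 1 there. A dominated linear form attaining this value at \<open>x - y\<close> is continuous
  and separates the two points.\<close>

theorem topological_dual_separates:
  fixes x y :: "'a::locally_convex_t2"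
  assumes "x \<noteq> y"
  shows "\<exists>f\<in>topological_dual. f x \<noteq> f y"
proof -
  obtain U where "open U" "0 \<in> U" "x - y \<notin> U"
    using t1_space[of 0 "x - y"] assms by auto
  then obtain V where V: "open V" "convex V" "0 \<in> V" "x - y \<notin> V"
    using convex_nhds_base by blast
  obtain f where f: "linear f" "\<forall>z. f z \<le> minkowski V z" "f (x - y) = minkowski V (x - y)"
    using hahn_banach_sublinear[OF sublinear_minkowski[OF V(1-3)]] by blast
  have "f \<in> topological_dual"
    using f linear_le_minkowski_continuous[OF V(1-3)] by (auto simp: topological_dual_def)
  moreover have "f x \<noteq> f y"
    using minkowski_ge_1[OF V] f(3) by (simp add: linear_diff[OF f(1)])
  ultimately show ?thesis
    by blast
qed

section \<open>Barycenters\<close>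

text \<open>The first-order condition at a minimum: for small \<open>t\<close> the linear term
  dominates the quadratic one.\<close>

lemma nonneg_if_quadratic_nonneg:
  fixes B D :: real
  assumes "0 \<le> D" and quad: "\<And>t. 0 < t \<Longrightarrow> t \<le> 1 \<Longrightarrow> 0 \<le> 2 * t * B + t\<^sup>2 * D"
  shows "0 \<le> B"
proof (rule ccontr)
  assume B: "\<not> 0 \<le> B"
  \<comment> \<open>This choice gives \<open>t * D <= - B\<close>, so
    \<open>2 * B + t * D <= B < 0\<close>. The denominator \<open>D + 1\<close> is positive even
    when \<open>D = 0\<close>.\<close>
  define t where "t = min 1 (- B / (D + 1))"
  have t: "0 < t" "t \<le> 1" "t \<le> - B / (D + 1)"
    using B \<open>0 \<le> D\<close> by (auto simp: t_def divide_neg_pos)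
  have "t * D \<le> t * (D + 1)"
    using t by simp
  also have "\<dots> \<le> - B"
    using t(3) \<open>0 \<le> D\<close> by (simp add: field_simps)
  finally have "2 * B + t * D < 0"
    using B by simp
  then have "t * (2 * B + t * D) < 0"
    using t(1) by (simp add: mult_pos_neg)
  then show False
    using quad[OF t(1,2)] by (simp add: power2_eq_square algebra_simps)
qed

lemma dual_borel_measurable:
  assumes "f \<in> topological_dual" "sets M = sets (restrict_space borel E)"
  shows "f \<in> borel_measurable M"
proof -
  have "f \<in> borel_measurable (restrict_space borel E)"
    using assms(1) by (intro borel_measurable_continuous_on_restrict)
      (auto simp: topological_dual_def intro: continuous_on_subset)
  then show ?thesis
    using measurable_cong_sets[OF assms(2) refl] by blast
qed

context
  fixes K E :: "'a::locally_convex_t2 set" and M :: "'a measure"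
  assumes K: "convex K" "compact K" and E: "E \<subseteq> K"
    and M: "prob_space M" "sets M = sets (restrict_space borel E)"
begin

interpretation prob_space M
  by (fact M(1))

lemma space_subset: "space M \<subseteq> K"
  using sets_eq_imp_space_eq[OF M(2)] E by (simp add: space_restrict_space)

text \<open>\<open>M\<close> lives on the compact set \<open>K\<close>, where a continuous form is
  bounded.\<close>

lemma dual_integrable:
  assumes f: "f \<in> topological_dual"
  shows "integrable M f"
proof -
  have "bounded (f ` K)"
    using f by (intro compact_imp_bounded compact_continuous_image K)
      (auto simp: topological_dual_def intro: continuous_on_subset)
  then obtain B where "\<And>x. x \<in> K \<Longrightarrow> norm (f x) \<le> B"
    unfolding bounded_iff by auto
  then show ?thesis
    using space_subset by (intro integrable_const_bound[of _ B] dual_borel_measurable[OF f M(2)] AE_I2) auto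
qed

text \<open>A minimiser \<open>x\<close> of \<open>\<Sum>f. (f x - \<integral>f)\<^sup>2\<close> over \<open>K\<close> satisfies a variational
  inequality; integrating it with respect to \<open>M\<close> shows that the minimum is zero.\<close>

lemma finite_barycenter:
  assumes "finite I" "I \<subseteq> topological_dual"
  shows "\<exists>x\<in>K. \<forall>f\<in>I. f x = integral\<^sup>L M f"
proof -
  define m where "m f = integral\<^sup>L M f" for f :: "'a \<Rightarrow> real"
  define G where "G x = (\<Sum>f\<in>I. (f x - m f)\<^sup>2)" for x
  have lin: "linear f" and int: "integrable M f" if "f \<in> I" for f
    using that assms(2) dual_integrable by (auto simp: topological_dual_def)
  have "continuous_on K G"
    unfolding G_def using assms(2) by (intro continuous_intros)
      (auto simp: topological_dual_def intro: continuous_on_subset)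
  moreover have "K \<noteq> {}"
    using space_subset not_empty by blast
  ultimately obtain x where x: "x \<in> K" "\<And>y. y \<in> K \<Longrightarrow> G x \<le> G y"
    using continuous_attains_inf[OF K(2)] by blast
  \<comment> \<open>\<open>B y\<close> is half the derivative of \<open>G\<close> at
    \<open>x\<close> in the direction \<open>y - x\<close>; it is nonnegative for \<open>y\<close>
    in \<open>K\<close> because \<open>x\<close> is a minimiser.\<close>
  define B where "B y = (\<Sum>f\<in>I. (f x - m f) * (f y - f x))" for y
  have "0 \<le> B y" if y: "y \<in> K" for y
  proof (rule nonneg_if_quadratic_nonneg)
    show "0 \<le> (\<Sum>f\<in>I. (f y - f x)\<^sup>2)"
      by (intro sum_nonneg) simp
    fix t :: real assume t: "0 < t" "t \<le> 1"
    have "(1 - t) *\<^sub>R x + t *\<^sub>R y \<in> K"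
      using t x y K(1) by (intro convexD) auto
    then have "G x \<le> G ((1 - t) *\<^sub>R x + t *\<^sub>R y)"
      by (rule x(2))
    also have "\<dots> = (\<Sum>f\<in>I. ((1 - t) * f x + t * f y - m f)\<^sup>2)"
      unfolding G_def by (intro sum.cong refl) (simp add: lin linear_add linear_scale)
    also have "\<dots> = (\<Sum>f\<in>I. (f x - m f)\<^sup>2 + 2 * t * ((f x - m f) * (f y - f x)) + t\<^sup>2 * (f y - f x)\<^sup>2)"
      by (intro sum.cong refl) (simp add: power2_eq_square algebra_simps)
    also have "\<dots> = G x + (2 * t * B y + t\<^sup>2 * (\<Sum>f\<in>I. (f y - f x)\<^sup>2))"
      by (simp add: G_def B_def sum.distrib sum_distrib_left)
    finally show "0 \<le> 2 * t * B y + t\<^sup>2 * (\<Sum>f\<in>I. (f y - f x)\<^sup>2)"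
      by simp
  qed
  then have "0 \<le> integral\<^sup>L M B"
    using space_subset by (intro integral_nonneg_AE AE_I2) auto
  \<comment> \<open>Integration replaces each \<open>f y\<close> by its mean \<open>m f\<close>, so
    the direction points exactly at the target and the derivative becomes
    \<open>- G x\<close>.\<close>
  also have "integral\<^sup>L M B = (\<Sum>f\<in>I. (f x - m f) * (m f - f x))"
    unfolding B_def using int by (subst Bochner_Integration.integral_sum) (auto simp: m_def prob_space)
  also have "\<dots> = - G x"
    unfolding G_def sum_negf[symmetric] by (intro sum.cong refl) (simp add: power2_eq_square algebra_simps)
  finally have "G x = 0"
    unfolding G_def using sum_nonneg[of I "\<lambda>f. (f x - m f)\<^sup>2"] by simp
  then have "\<forall>f\<in>I. f x = m f"
    unfolding G_def using assms(1) by (subst (asm) sum_nonneg_eq_0_iff) auto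
  then show ?thesis
    using x(1) unfolding m_def by blast
qed

text \<open>Each form imposes a closed condition on \<open>x\<close>, and finitely many conditions
  can be met in \<open>K\<close> by \<open>finite_barycenter\<close>. Compactness yields a point
  meeting all of them.\<close>

lemma barycenter_exists: "\<exists>x\<in>K. represents M x"
proof -
  have "K \<inter> (\<Inter>f\<in>topological_dual. {x. f x = integral\<^sup>L M f}) \<noteq> {}"
  proof (rule compact_imp_fip_image[OF K(2)])
    fix f assume "f \<in> (topological_dual :: ('a \<Rightarrow> real) set)"
    then show "closed {x. f x = integral\<^sup>L M f}"
      by (intro closed_Collect_eq) (auto simp: topological_dual_def)
  next
    fix I assume "finite I" "I \<subseteq> (topological_dual :: ('a \<Rightarrow> real) set)"
    from finite_barycenter[OF this] obtain x where "x \<in> K" "\<forall>f\<in>I. f x = integral\<^sup>L M f" ..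
    then have "x \<in> K \<inter> (\<Inter>f\<in>I. {x. f x = integral\<^sup>L M f})"
      by simp
    then show "K \<inter> (\<Inter>f\<in>I. {x. f x = integral\<^sup>L M f}) \<noteq> {}"
      by (metis emptyE)
  qed
  then show ?thesis
    using dual_integrable by (auto simp: represents_def has_bochner_integral_iff)
qed

end

lemma represents_unique: "represents M x \<Longrightarrow> represents M y \<Longrightarrow> x = y"
  using topological_dual_separates[of x y] has_bochner_integral_eq unfolding represents_def by blast

text \<open>Eliminates the definite description, so that fibres can be handled through
  \<open>represents\<close> alone.\<close>

lemma resultant_eq_iff:
  assumes "convex K" "compact K" "M \<in> radon_prob (Ext K)"
  shows "resultant K M = x \<longleftrightarrow> x \<in> K \<and> represents M x"
proof -
  have "\<exists>x\<in>K. represents M x"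
    using assms by (intro barycenter_exists[of K "Ext K"])
      (auto simp: radon_prob_def Ext_def extreme_point_of_def)
  then obtain z where z: "z \<in> K" "represents M z"
    by blast
  then have "resultant K M = z"
    unfolding resultant_def by (intro the_equality) (auto intro: represents_unique)
  then show ?thesis
    using z represents_unique by metis
qed

section \<open>Extreme points and lower bounds\<close>

text \<open>A segment in one factor lifts to the product by freezing the other coordinate.
  Conversely, a segment through a pair of extreme points must be constant in each coordinate, hence
  degenerate.\<close>

lemma Ext_Times: "Ext (A \<times> B) = Ext A \<times> Ext B"
proof (intro equalityI subsetI)
  fix p assume p: "p \<in> Ext (A \<times> B)"
  obtain x y where xy: "p = (x, y)"
    by (cases p)
  have mem: "x \<in> A" "y \<in> B"
    and ext: "\<And>a b. a \<in> A \<times> B \<Longrightarrow> b \<in> A \<times> B \<Longrightarrow> (x, y) \<notin> open_segment a b"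
    using p by (auto simp: xy Ext_def extreme_point_of_def)
  have "x \<notin> open_segment a b" if "a \<in> A" "b \<in> A" for a b
    using ext[of "(a, y)" "(b, y)"] that mem by (auto simp: in_segment scaleR_add_left[symmetric])
  moreover have "y \<notin> open_segment a b" if "a \<in> B" "b \<in> B" for a b
    using ext[of "(x, a)" "(x, b)"] that mem by (auto simp: in_segment scaleR_add_left[symmetric])
  ultimately show "p \<in> Ext A \<times> Ext B"
    using mem by (auto simp: xy Ext_def extreme_point_of_def)
next
  fix p assume "p \<in> Ext A \<times> Ext B"
  then obtain x y where p: "p = (x, y)" "x \<in> A" "y \<in> B"
    and x: "\<And>a b. a \<in> A \<Longrightarrow> b \<in> A \<Longrightarrow> x \<notin> open_segment a b"
    and y: "\<And>a b. a \<in> B \<Longrightarrow> b \<in> B \<Longrightarrow> y \<notin> open_segment a b"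
    by (auto simp: Ext_def extreme_point_of_def)
  have "(x, y) \<notin> open_segment (a, b) (a', b')" if mem: "a \<in> A" "b \<in> B" "a' \<in> A" "b' \<in> B" for a b a' b'
  proof
    assume seg: "(x, y) \<in> open_segment (a, b) (a', b')"
    then have "a = a'"
      using x[OF mem(1,3)] by (auto simp: in_segment)
    moreover have "b = b'"
      using seg y[OF mem(2,4)] by (auto simp: in_segment)
    ultimately show False
      using seg by (simp add: in_segment)
  qed
  then show "p \<in> Ext (A \<times> B)"
    using p by (auto simp: Ext_def extreme_point_of_def)
qed

lemma not_extreme_point_imp_midpoint:
  assumes "convex K" "x \<in> K" "x \<notin> Ext K"
  shows "\<exists>y\<in>K. \<exists>z\<in>K. y \<noteq> z \<and> x = midpoint y z"
proof -
  obtain a b u where ab: "a \<in> K" "b \<in> K" "a \<noteq> b"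
    and u: "0 < u" "u < 1" "x = (1 - u) *\<^sub>R a + u *\<^sub>R b"
    using assms(2,3) by (auto simp: Ext_def extreme_point_of_def in_segment)
  \<comment> \<open>The largest radius for which the interval centred at \<open>u\<close> stays
    inside [0, 1]; its endpoints parametrise the two points with midpoint \<open>x\<close>.\<close>
  define d where "d = min u (1 - u)"
  define pt where "pt s = (1 - s) *\<^sub>R a + s *\<^sub>R b" for s
  have d: "0 < d" "d \<le> u" "d \<le> 1 - u"
    using u by (auto simp: d_def)
  have "pt s \<in> K" if "0 \<le> s" "s \<le> 1" for s
    unfolding pt_def using that ab assms(1) by (intro convexD) auto
  then have "pt (u - d) \<in> K" "pt (u + d) \<in> K"
    using d u by auto
  moreover have "pt (u + d) - pt (u - d) = (2 * d) *\<^sub>R (b - a)"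
    by (simp add: pt_def algebra_simps scaleR_2[symmetric])
  then have "pt (u - d) \<noteq> pt (u + d)"
    using ab d by auto
  moreover have "pt s + pt t = 2 *\<^sub>R a + (s + t) *\<^sub>R (b - a)" for s t
    by (simp add: pt_def algebra_simps scaleR_2)
  then have "pt (u - d) + pt (u + d) = 2 *\<^sub>R (a + u *\<^sub>R (b - a))"
    by (simp add: scaleR_add_right)
  then have "pt (u - d) + pt (u + d) = 2 *\<^sub>R x"
    by (simp add: u algebra_simps)
  then have "x = midpoint (pt (u - d)) (pt (u + d))"
    by (simp add: midpoint_def)
  ultimately show ?thesis
    by blast
qed

lemma midpoint_notin_Ext: "y \<in> K \<Longrightarrow> z \<in> K \<Longrightarrow> y \<noteq> z \<Longrightarrow> midpoint y z \<notin> Ext K"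
proof -
  assume yz: "y \<in> K" "z \<in> K" "y \<noteq> z"
  have "midpoint y z = (1 - 1 / 2) *\<^sub>R y + (1 / 2) *\<^sub>R z"
    by (simp add: midpoint_def scaleR_add_right)
  then have "midpoint y z \<in> open_segment y z"
    unfolding in_segment using yz(3) by (intro conjI exI[of _ "1 / 2"]) auto
  then show ?thesis
    using yz unfolding Ext_def extreme_point_of_def by blast
qed

text \<open>Stability makes the set of nonextreme points relatively open, so \<open>Ext K\<close> is
  closed in the compact set \<open>K\<close>.\<close>

lemma compact_Ext:
  fixes K :: "'a::locally_convex_t2 set"
  assumes "convex K" "compact K" "stable_set K"
  shows "compact (Ext K)"
proof -
  have "openin (top_of_set K) (K - Ext K)"
  proof (subst openin_subopen, intro ballI)
    fix x assume "x \<in> K - Ext K"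
    then obtain y z where yz: "y \<in> K" "z \<in> K" "y \<noteq> z" "x = midpoint y z"
      using not_extreme_point_imp_midpoint[OF assms(1)] by blast
    obtain U W where UW: "open U" "open W" "y \<in> U" "z \<in> W" "U \<inter> W = {}"
      using hausdorff[OF yz(3)] by blast
    \<comment> \<open>Disjoint \<open>U\<close> and \<open>W\<close> keep the two endpoints
      distinct, so every midpoint in \<open>N\<close> is nonextreme. \<open>N\<close> is relatively
      open since the midpoint map is open.\<close>
    define N where "N = (\<lambda>(x, y). midpoint x y) ` ((K \<times> K) \<inter> (U \<times> W))"
    have "openin (top_of_set (K \<times> K)) ((K \<times> K) \<inter> (U \<times> W))"
      using UW by (intro openin_open_Int open_Times)
    then have "openin (top_of_set K) N"
      using assms(3) by (simp add: stable_set_def open_map_def N_def)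
    moreover have "x \<in> N"
      using yz UW by (force simp: N_def)
    moreover have "N \<subseteq> K - Ext K"
    proof
      fix w assume "w \<in> N"
      then obtain a b where ab: "a \<in> K" "b \<in> K" "a \<in> U" "b \<in> W" "w = midpoint a b"
        by (auto simp: N_def)
      then have "w \<notin> Ext K"
        using UW midpoint_notin_Ext[of a K b] by blast
      moreover have "w \<in> K"
        using \<open>openin (top_of_set K) N\<close> \<open>w \<in> N\<close> openin_imp_subset by blast
      ultimately show "w \<in> K - Ext K"
        by blast
    qed
    ultimately show "\<exists>T. openin (top_of_set K) T \<and> x \<in> T \<and> T \<subseteq> K - Ext K"
      by blast
  qed
  moreover have "Ext K \<subseteq> K"
    by (auto simp: Ext_def extreme_point_of_def)
  ultimately have "closedin (top_of_set K) (Ext K)"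
    by (simp add: closedin_def)
  then show ?thesis
    using assms(2) closedin_compact by blast
qed

section \<open>Lower bounds for the cost and its integral\<close>

text \<open>The sets where \<open>g > -n\<close> are relatively open and cover \<open>E\<close>
  because \<open>g\<close> avoids minus infinity. The largest index in a finite subcover provides
  the bound.\<close>

lemma lsc_on_compact_bounded_below:
  assumes "compact E" "lsc_on E g" "\<forall>x\<in>E. g x \<noteq> -\<infinity>"
  shows "\<exists>b::real. \<forall>x\<in>E. ereal b \<le> g x"
proof -
  define U where "U n = {x \<in> E. ereal (- real n) < g x}" for n :: nat
  have "E \<subseteq> (\<Union>n. U n)"
  proof
    fix x assume x: "x \<in> E"
    obtain n :: nat where "- g x < ereal (real n)"
      using less_PInf_Ex_of_nat[of "- g x"] x assms(3) by (auto simp: ereal_uminus_eq_reorder)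
    then have "ereal (- real n) < g x"
      using ereal_minus_less_minus[of "g x" "ereal (- real n)"] by simp
    then show "x \<in> (\<Union>n. U n)"
      using x by (auto simp: U_def)
  qed
  moreover have "\<forall>T\<in>range U. openin (top_of_set E) T"
    using assms(2) by (auto simp: lsc_on_def U_def)
  ultimately obtain D where D: "D \<subseteq> range U" "finite D" "E \<subseteq> \<Union>D"
    using assms(1) unfolding compact_eq_openin_cover by meson
  then obtain I where I: "finite I" "D = U ` I"
    by (meson finite_subset_image)
  have "ereal (- real (Max I)) \<le> g x" if "x \<in> E" for x
  proof -
    obtain n where n: "n \<in> I" "x \<in> U n"
      using D(3) I \<open>x \<in> E\<close> by blast
    then have "ereal (- real (Max I)) \<le> ereal (- real n)"
      using I(1) by simp
    also have "\<dots> \<le> g x"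
      using n by (simp add: U_def less_imp_le)
    finally show ?thesis .
  qed
  then show ?thesis
    by blast
qed

text \<open>The negative part is at most \<open>- b\<close> and the mass is 1. The integral of the
  positive part is only bounded below by 0, so the estimate is stated for
  \<open>b <= 0\<close>.\<close>

lemma ereal_integral_ge:
  assumes "prob_space M" "b \<le> 0" "\<And>x. x \<in> space M \<Longrightarrow> ereal b \<le> g x"
  shows "ereal b \<le> ereal_integral M g"
proof -
  interpret prob_space M
    by (fact assms(1))
  have "(\<integral>\<^sup>+x. e2ennreal (- g x) \<partial>M) \<le> (\<integral>\<^sup>+x. ennreal (- b) \<partial>M)"
  proof (rule nn_integral_mono)
    fix x assume "x \<in> space M"
    then have "- g x \<le> ereal (- b)"
      using assms(3) ereal_minus_le_minus[of "g x" "ereal b"] by simp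
    then show "e2ennreal (- g x) \<le> ennreal (- b)"
      using e2ennreal_mono[of "- g x" "ereal (- b)"] by simp
  qed
  then have "(\<integral>\<^sup>+x. e2ennreal (- g x) \<partial>M) \<le> ennreal (- b)"
    by (simp add: emeasure_space_1)
  then have "enn2ereal (\<integral>\<^sup>+x. e2ennreal (- g x) \<partial>M) \<le> ereal (- b)"
    using assms(2) by (metis enn2ereal_ennreal le_minus_iff less_eq_ennreal.rep_eq minus_zero)
  then have "0 - ereal (- b) \<le> ereal_integral M g"
    unfolding ereal_integral_def by (intro ereal_minus_mono enn2ereal_nonneg)
  then show ?thesis
    by simp
qed

section \<open>Marginals and fibres of the resultant map\<close>

lemma space_radon_prob: "M \<in> radon_prob E \<Longrightarrow> space M = E"
  using sets_eq_imp_space_eq[of M "restrict_space borel E"]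
  by (simp add: radon_prob_def space_restrict_space)

lemma measurable_radon_prob:
  assumes "M \<in> radon_prob E" "continuous_on E g" "g ` E \<subseteq> F"
  shows "g \<in> measurable M (restrict_space borel F)"
proof -
  have "g \<in> measurable (restrict_space borel E) (restrict_space borel F)"
    using assms(2,3)
    by (intro measurable_restrict_space2 borel_measurable_continuous_on_restrict)
      (auto simp: space_restrict_space)
  then show ?thesis
    using assms(1) measurable_cong_sets[of M "restrict_space borel E"]
    by (auto simp: radon_prob_def)
qed

lemma compact_in_sets_restrict:
  fixes K :: "'a::t2_space set"
  assumes "compact K" "K \<subseteq> E"
  shows "K \<in> sets (restrict_space borel E)"
proof -
  have "K \<in> sets borel"
    using assms(1) by (simp add: compact_imp_closed)
  then show ?thesis
    using assms(2) by (auto simp: sets_restrict_space)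
qed

text \<open>Inner regularity is transported by images: a compact \<open>K\<close> inside the
  preimage of \<open>A\<close> has compact image inside \<open>A\<close>, and the preimage of that
  image contains \<open>K\<close>.\<close>

lemma radon_prob_distr:
  fixes M :: "'a::t2_space measure" and F :: "'b::t2_space set"
  assumes M: "M \<in> radon_prob E" and g: "continuous_on E g" "g ` E \<subseteq> F"
  shows "distr M (restrict_space borel F) g \<in> radon_prob F"
proof -
  let ?N = "distr M (restrict_space borel F) g"
  note meas = measurable_radon_prob[OF assms]
  have sp: "space M = E"
    by (rule space_radon_prob[OF M])
  have M': "prob_space M" "sets M = sets (restrict_space borel E)"
    and reg: "\<And>A. A \<in> sets M \<Longrightarrow> emeasure M A = (SUP K\<in>{K. compact K \<and> K \<subseteq> A}. emeasure M K)"
    using M by (auto simp: radon_prob_def)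
  have "emeasure ?N A = (SUP K\<in>{K. compact K \<and> K \<subseteq> A}. emeasure ?N K)"
    if A: "A \<in> sets ?N" for A
  proof (rule antisym)
    have AF: "A \<subseteq> F"
      using sets.sets_into_space[OF A] by (simp add: space_restrict_space)
    have pre: "g -` A \<inter> E \<in> sets M"
      using measurable_sets[OF meas, of A] A by (simp add: sp)
    have "emeasure ?N A = emeasure M (g -` A \<inter> E)"
      using A meas by (simp add: emeasure_distr sp)
    also have "\<dots> = (SUP K\<in>{K. compact K \<and> K \<subseteq> g -` A \<inter> E}. emeasure M K)"
      by (rule reg[OF pre])
    also have "\<dots> \<le> (SUP K\<in>{K. compact K \<and> K \<subseteq> A}. emeasure ?N K)"
    proof (rule SUP_mono, safe)
      fix K assume K: "compact K" "K \<subseteq> g -` A \<inter> E"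
      have gK: "compact (g ` K)" "g ` K \<subseteq> A"
        using K g(1) by (auto intro!: compact_continuous_image elim: continuous_on_subset)
      then have sets: "g ` K \<in> sets (restrict_space borel F)"
        using AF by (intro compact_in_sets_restrict) auto
      have "emeasure M K \<le> emeasure M (g -` (g ` K) \<inter> space M)"
        using K measurable_sets[OF meas sets] by (intro emeasure_mono) (auto simp: sp)
      also have "\<dots> = emeasure ?N (g ` K)"
        using meas sets by (simp add: emeasure_distr)
      finally show "\<exists>L\<in>{K. compact K \<and> K \<subseteq> A}. emeasure M K \<le> emeasure ?N L"
        using gK by blast
    qed
    finally show "emeasure ?N A \<le> (SUP K\<in>{K. compact K \<and> K \<subseteq> A}. emeasure ?N K)" .
    show "(SUP K\<in>{K. compact K \<and> K \<subseteq> A}. emeasure ?N K) \<le> emeasure ?N A"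
      using A by (intro SUP_least emeasure_mono) auto
  qed
  then show ?thesis
    unfolding radon_prob_def using prob_space.prob_space_distr[OF M'(1) meas] by simp
qed

lemma dual_compose:
  assumes "f \<in> topological_dual" "linear h" "continuous_on UNIV h"
  shows "(\<lambda>x. f (h x)) \<in> topological_dual"
  using assms linear_compose[of h f] continuous_on_compose2[of UNIV f UNIV h]
  by (simp add: topological_dual_def o_def)

lemma represents_distr_iff:
  assumes g: "g \<in> measurable M (restrict_space borel F)"
  shows "represents (distr M (restrict_space borel F) g) x \<longleftrightarrow>
    (\<forall>f\<in>topological_dual. has_bochner_integral M (\<lambda>p. f (g p)) (f x))"
  unfolding represents_def
proof (rule ball_cong[OF refl])
  fix f assume "f \<in> (topological_dual :: ('b \<Rightarrow> real) set)"
  then have "f \<in> borel_measurable (restrict_space borel F)"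
    by (rule dual_borel_measurable) simp
  then show "has_bochner_integral (distr M (restrict_space borel F) g) f (f x) \<longleftrightarrow>
      has_bochner_integral M (\<lambda>p. f (g p)) (f x)"
    using g by (simp add: has_bochner_integral_iff integrable_distr_eq integral_distr)
qed

text \<open>Composing forms with the projections gives the forward direction. For the converse, a
  form on the product is split into its restrictions to the two coordinate subspaces.\<close>

lemma represents_Pair_iff:
  fixes M :: "('a::locally_convex_t2 \<times> 'b::locally_convex_t2) measure"
  assumes fst: "fst \<in> measurable M (restrict_space borel E)"
    and snd: "snd \<in> measurable M (restrict_space borel F)"
  shows "represents M (x, y) \<longleftrightarrow>
    represents (distr M (restrict_space borel E) fst) x \<and>
    represents (distr M (restrict_space borel F) snd) y"
  unfolding represents_distr_iff[OF fst] represents_distr_iff[OF snd]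
proof safe
  fix f :: "'a \<Rightarrow> real" assume "represents M (x, y)" "f \<in> topological_dual"
  moreover have "(\<lambda>p::'a \<times> 'b. f (fst p)) \<in> topological_dual"
    by (rule dual_compose[OF \<open>f \<in> topological_dual\<close>]) (auto intro!: linear_fst continuous_intros)
  ultimately show "has_bochner_integral M (\<lambda>p. f (fst p)) (f x)"
    unfolding represents_def by fastforce
next
  fix f :: "'b \<Rightarrow> real" assume "represents M (x, y)" "f \<in> topological_dual"
  moreover have "(\<lambda>p::'a \<times> 'b. f (snd p)) \<in> topological_dual"
    by (rule dual_compose[OF \<open>f \<in> topological_dual\<close>]) (auto intro!: linear_snd continuous_intros)
  ultimately show "has_bochner_integral M (\<lambda>p. f (snd p)) (f y)"
    unfolding represents_def by fastforce
next
  assume 1: "\<forall>f\<in>topological_dual. has_bochner_integral M (\<lambda>p. f (fst p)) (f x)"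
    and 2: "\<forall>f\<in>topological_dual. has_bochner_integral M (\<lambda>p. f (snd p)) (f y)"
  show "represents M (x, y)"
    unfolding represents_def
  proof
    fix f assume f: "f \<in> (topological_dual :: ('a \<times> 'b \<Rightarrow> real) set)"
    then have split: "f (u, v) = f (u, 0) + f (0, v)" for u v
      using linear_add[of f "(u, 0)" "(0, v)"] by (simp add: topological_dual_def)
    have "(\<lambda>u. f (u, 0)) \<in> topological_dual" "(\<lambda>v. f (0, v)) \<in> topological_dual"
      by (rule dual_compose[OF f]; auto intro!: linearI continuous_intros)+
    then have "has_bochner_integral M (\<lambda>p. f (fst p, 0) + f (0, snd p)) (f (x, 0) + f (0, y))"
      using 1 2 by (intro has_bochner_integral_add) auto
    then show "has_bochner_integral M f (f (x, y))"
      by (simp add: split[symmetric])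
  qed
qed

text \<open>A coupling determines the measures it couples, so lying in the union means exactly that
  both marginals lie in the respective fibres. The marginals are Radon by
  \<open>radon_prob_distr\<close>.\<close>

lemma resultant_fibre_Times:
  fixes C1 :: "'a::locally_convex_t2 set" and C2 :: "'b::locally_convex_t2 set"
  assumes C1: "convex C1" "compact C1" and C2: "convex C2" "compact C2"
  shows "resultant_fibre (C1 \<times> C2) (x1, x2) =
    (\<Union>\<mu>1\<in>resultant_fibre C1 x1. \<Union>\<mu>2\<in>resultant_fibre C2 x2. couplings (Ext C1) (Ext C2) \<mu>1 \<mu>2)"
proof -
  have "resultant (C1 \<times> C2) M = (x1, x2) \<longleftrightarrow>
      distr M (restrict_space borel (Ext C1)) fst \<in> resultant_fibre C1 x1 \<and>
      distr M (restrict_space borel (Ext C2)) snd \<in> resultant_fibre C2 x2"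
    if M: "M \<in> radon_prob (Ext C1 \<times> Ext C2)" for M
  proof -
    have cont: "continuous_on (Ext C1 \<times> Ext C2) fst" "continuous_on (Ext C1 \<times> Ext C2) snd"
      by (intro continuous_intros)+
    have sub: "fst ` (Ext C1 \<times> Ext C2) \<subseteq> Ext C1" "snd ` (Ext C1 \<times> Ext C2) \<subseteq> Ext C2"
      by auto
    note radon = radon_prob_distr[OF M cont(1) sub(1)] radon_prob_distr[OF M cont(2) sub(2)]
    note meas = measurable_radon_prob[OF M cont(1) sub(1)] measurable_radon_prob[OF M cont(2) sub(2)]
    have "resultant (C1 \<times> C2) M = (x1, x2) \<longleftrightarrow> (x1, x2) \<in> C1 \<times> C2 \<and> represents M (x1, x2)"
      using assms M by (intro resultant_eq_iff) (simp_all add: convex_Times compact_Times Ext_Times)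
    then show ?thesis
      using radon C1 C2 by (auto simp: resultant_fibre_def resultant_eq_iff represents_Pair_iff[OF meas])
  qed
  then show ?thesis
    by (auto simp: resultant_fibre_def[of "C1 \<times> C2"] Ext_Times couplings_def)
qed

lemma INF_UN: "(INF x\<in>(\<Union>y\<in>A. g y). f x) = (INF y\<in>A. INF x\<in>g y. f x :: 'c::complete_lattice)"
  by (rule order_antisym) (blast intro: INF_greatest INF_lower2)+

theorem proposition1p4:
  fixes C1 :: "'a::locally_convex_t2 set" and C2 :: "'b::locally_convex_t2 set"
    and c :: "'a \<times> 'b \<Rightarrow> ereal"
  assumes "convex C1" "compact C1" "metrizable_space (top_of_set C1)" "stable_set C1"
    and "convex C2" "compact C2" "metrizable_space (top_of_set C2)" "stable_set C2"
    and "\<forall>p \<in> Ext C1 \<times> Ext C2. c p \<noteq> -\<infinity>"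
    and "lsc_on (Ext C1 \<times> Ext C2) c"
  shows "\<forall>x1\<in>C1. \<forall>x2\<in>C2.
    convex_roof (C1 \<times> C2) c (x1, x2) \<noteq> -\<infinity> \<and>
    convex_roof (C1 \<times> C2) c (x1, x2) =
      (INF \<mu>1\<in>resultant_fibre C1 x1. INF \<mu>2\<in>resultant_fibre C2 x2.
         kantorovich_cost (Ext C1) (Ext C2) c \<mu>1 \<mu>2)"
proof (intro ballI conjI)
  fix x1 x2
  have "compact (Ext C1 \<times> Ext C2)"
    using assms by (intro compact_Times compact_Ext)
  then obtain b' where b': "\<forall>p\<in>Ext C1 \<times> Ext C2. ereal b' \<le> c p"
    using lsc_on_compact_bounded_below assms(9,10) by blast
  \<comment> \<open>Truncation at 0 provides the nonpositive bound required by
    \<open>ereal_integral_ge\<close>.\<close>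
  define b where "b = min b' 0"
  have "b \<le> 0" and b: "\<And>p. p \<in> Ext C1 \<times> Ext C2 \<Longrightarrow> ereal b \<le> c p"
    using b' by (auto simp: b_def simp del: ereal_min intro: order_trans[of _ "ereal b'"])
  have "ereal b \<le> convex_roof (C1 \<times> C2) c (x1, x2)"
    unfolding convex_roof_def
  proof (rule INF_greatest)
    fix \<pi> assume "\<pi> \<in> resultant_fibre (C1 \<times> C2) (x1, x2)"
    then have \<pi>: "\<pi> \<in> radon_prob (Ext C1 \<times> Ext C2)"
      by (simp add: resultant_fibre_def Ext_Times)
    then show "ereal b \<le> ereal_integral \<pi> c"
      using b \<open>b \<le> 0\<close> space_radon_prob[OF \<pi>]
      by (intro ereal_integral_ge) (auto simp: radon_prob_def)
  qed
  then show "convex_roof (C1 \<times> C2) c (x1, x2) \<noteq> -\<infinity>"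
    by auto
  show "convex_roof (C1 \<times> C2) c (x1, x2) =
      (INF \<mu>1\<in>resultant_fibre C1 x1. INF \<mu>2\<in>resultant_fibre C2 x2.
         kantorovich_cost (Ext C1) (Ext C2) c \<mu>1 \<mu>2)"
    using assms by (simp add: convex_roof_def kantorovich_cost_def resultant_fibre_Times INF_UN)
qed

end
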